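(* Let $a,b\in\mathbb{R}$ with $a^2>b^2$, let $G$ be the Green's function of the problem $u'(t)+a\,u(-t)+b\,u(t)=h(t)$ for a.e. $t\in\mathbb{R}$, $u(t_0)=c$ (given in the context), and define $$\eta(a,b):=\begin{cases}\frac{1}{\sqrt{a^2-b^2}}\arctan\frac{\sqrt{a^2-b^2}}{b}, & b>0,\\ \frac{\pi}{2|a|}, & b=0,\\ \frac{1}{\sqrt{a^2-b^2}}\Big(\arctan\frac{\sqrt{a^2-b^2}}{b}+\pi\Big), & b<0.\end{cases}$$ Then: (i) if $a>0$, $G$ is non-negative on $[0,\eta(a,b)]\times\mathbb{R}$; (ii) if $a<0$, $G$ is non-positive on $[-\eta(a,-b),0]\times\mathbb{R}$; (iii) $G$ changes sign in any other strip not a subset of the aforementioned.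
   Context: Here $h\in L^1_{\mathrm{loc}}(\mathbb{R})$ and $t_0,c\in\mathbb{R}$. Strips are sets of the kind $[\alpha,\beta]\times\mathbb{R}$ in the $(t,s)$-plane. For $t_1,t_2\in\mathbb{R}$ the oriented characteristic function is $\chi_{t_1}^{t_2}(t)=1$ if $t_1\le t\le t_2$, $\chi_{t_1}^{t_2}(t)=-1$ if $t_2\le t<t_1$, and $0$ otherwise. The Green's function is $$G(t,s)=\tfrac12\Big(\big[\tilde u(-s)\tilde v(t)+\tilde v(-s)\tilde u(t)\big]\chi_0^t(s)+\big[\tilde u(-s)\tilde v(t)-\tilde v(-s)\tilde u(t)\big]\chi_{-t}^0(s)\Big),\quad t,s\in\mathbb{R},$$ where $\tilde u'(t)+a\tilde u(-t)+b\tilde u(t)=0$, $\tilde u(0)=1$ and $\tilde v'(t)-a\tilde v(-t)+b\tilde v(t)=0$, $\tilde v(0)=1$. For $a^2>b^2$ and $\omega=\sqrt{a^2-b^2}$ it is $$G(t,s)=\Big[\cos(\omega(s-t))+\frac b\omega\sin(\omega(s-t))\Big]\chi_0^t(s)+\frac a\omega\sin(\omega(s+t))\,\chi_{-t}^0(s),$$ which is rewritten as: $\cos\omega(s-t)+\frac b\omega\sin\omega(s-t)$ for $0\le s\le t$; $-\cos\omega(s-t)-\frac b\omega\sin\omega(s-t)$ for $t\le s\le 0$; $\frac a\omega\sin\omega(s+t)$ for $-t\le s\le 0$; $-\frac a\omega\sin\omega(s+t)$ for $0\le s\le -t$; and $0$ otherwise.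
   Formalization: In (ii), non-positivity is stated on the strip without the point (0,0), because the given oriented characteristic function makes G(0,0)=1 for all a, b; in (iii), the sign change is proved on the strip with (0,0) removed, which is stronger. *)

theory Defs
  imports "HOL-Analysis.Analysis"
begin

definition oriented_chi :: "real \<Rightarrow> real \<Rightarrow> real \<Rightarrow> real" where
  "oriented_chi t1 t2 t =
     (if t1 \<le> t \<and> t \<le> t2 then 1 else if t2 \<le> t \<and> t < t1 then -1 else 0)"

definition reflection_sol :: "real \<Rightarrow> real \<Rightarrow> (real \<Rightarrow> real) \<Rightarrow> bool" where
  "reflection_sol a b w \<longleftrightarrow>
     (\<forall>t. w differentiable (at t) \<and> deriv w t + a * w (- t) + b * w t = 0) \<and> w 0 = 1"

text \<open>The descriptions below are well defined for \<open>a\<^sup>2 > b\<^sup>2\<close>, by \<open>ex1_reflection_sol\<close>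
  applied to \<open>a\<close> and to \<open>- a\<close>.\<close>

definition utilde :: "real \<Rightarrow> real \<Rightarrow> real \<Rightarrow> real" where
  "utilde a b = (THE w. reflection_sol a b w)"

definition vtilde :: "real \<Rightarrow> real \<Rightarrow> real \<Rightarrow> real" where
  "vtilde a b = (THE w. reflection_sol (- a) b w)"

text \<open>Green's function of \<open>u'(t) + a u(- t) + b u(t) = h(t)\<close>, \<open>u(t0) = c\<close>; it does not depend
  on \<open>h\<close>, \<open>t0\<close> and \<open>c\<close>. Pitfall: the convention \<open>oriented_chi t t t = 1\<close> gives the origin the
  value \<open>1\<close> whatever the sign of \<open>a\<close> (see \<open>green_origin\<close>). For \<open>a < 0\<close> this is the
  only positive value on \<open>strip (- eta a (- b)) 0\<close>, so non-positivity there must leave out the origin.\<close>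

definition green :: "real \<Rightarrow> real \<Rightarrow> real \<Rightarrow> real \<Rightarrow> real" where
  "green a b t s = 1 / 2 *
     ((utilde a b (- s) * vtilde a b t + vtilde a b (- s) * utilde a b t) * oriented_chi 0 t s
    + (utilde a b (- s) * vtilde a b t - vtilde a b (- s) * utilde a b t) * oriented_chi (- t) 0 s)"

definition eta :: "real \<Rightarrow> real \<Rightarrow> real" where
  "eta a b =
     (if b > 0 then 1 / sqrt (a\<^sup>2 - b\<^sup>2) * arctan (sqrt (a\<^sup>2 - b\<^sup>2) / b)
      else if b = 0 then pi / (2 * \<bar>a\<bar>)
      else 1 / sqrt (a\<^sup>2 - b\<^sup>2) * (arctan (sqrt (a\<^sup>2 - b\<^sup>2) / b) + pi))"

definition strip :: "real \<Rightarrow> real \<Rightarrow> (real \<times> real) set" where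
  "strip \<alpha> \<beta> = {\<alpha>..\<beta>} \<times> UNIV"

definition nonneg_on :: "(real \<times> real) set \<Rightarrow> (real \<Rightarrow> real \<Rightarrow> real) \<Rightarrow> bool" where
  "nonneg_on S F \<longleftrightarrow> (\<forall>(t, s) \<in> S. F t s \<ge> 0)"

definition nonpos_on :: "(real \<times> real) set \<Rightarrow> (real \<Rightarrow> real \<Rightarrow> real) \<Rightarrow> bool" where
  "nonpos_on S F \<longleftrightarrow> (\<forall>(t, s) \<in> S. F t s \<le> 0)"

definition changes_sign_on :: "(real \<times> real) set \<Rightarrow> (real \<Rightarrow> real \<Rightarrow> real) \<Rightarrow> bool" where
  "changes_sign_on S F \<longleftrightarrow> (\<exists>(t, s) \<in> S. F t s > 0) \<and> (\<exists>(t, s) \<in> S. F t s < 0)"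

lemma reflection_sol_explicit:
  fixes a b :: real
  assumes "a\<^sup>2 > b\<^sup>2"
  defines "\<omega> \<equiv> sqrt (a\<^sup>2 - b\<^sup>2)"
  shows "reflection_sol a b (\<lambda>t. cos (\<omega> * t) - (a + b) / \<omega> * sin (\<omega> * t))"
    (is "reflection_sol a b ?w")
proof -
  have pos: "\<omega> > 0" and sq: "\<omega> * \<omega> = (a + b) * (a - b)"
    using assms by (simp_all add: power2_eq_square algebra_simps)
  have D: "(?w has_real_derivative - \<omega> * sin (\<omega> * t) - (a + b) * cos (\<omega> * t)) (at t)" for t
    using pos by (auto intro!: derivative_eq_intros)
  have "- \<omega> * sin (\<omega> * t) - (a + b) * cos (\<omega> * t) + a * ?w (- t) + b * ?w t = 0" for t
  proof -
    have "- \<omega> * sin (\<omega> * t) - (a + b) * cos (\<omega> * t) + a * ?w (- t) + b * ?w t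
        = ((a + b) * (a - b) - \<omega> * \<omega>) / \<omega> * sin (\<omega> * t)"
      using pos by (simp add: field_simps)
    then show ?thesis using sq by simp
  qed
  then show ?thesis
    unfolding reflection_sol_def using D DERIV_imp_deriv[OF D]
    by (auto simp: real_differentiable_def)
qed

lemma reflection_sol_unique:
  fixes a b :: real
  assumes ab: "a\<^sup>2 > b\<^sup>2" and w1: "reflection_sol a b w1" and w2: "reflection_sol a b w2"
  shows "w1 = w2"
proof -
  define d where "d t = w1 t - w2 t" for t
  have D: "(w has_real_derivative - a * w (- t) - b * w t) (at t)"
    if "reflection_sol a b w" for w t
  proof -
    have "w differentiable (at t)" "deriv w t = - a * w (- t) - b * w t"
      using that unfolding reflection_sol_def by (auto simp: algebra_simps eq_neg_iff_add_eq_0)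
    then show ?thesis
      by (metis DERIV_imp_deriv real_differentiable_def)
  qed
  have d': "(d has_real_derivative - a * d (- t) - b * d t) (at t)" for t
    unfolding d_def using DERIV_diff[OF D[OF w1, of t] D[OF w2, of t]]
    by (simp add: algebra_simps)
  have dm: "((\<lambda>t. d (- t)) has_real_derivative a * d t + b * d (- t)) (at t)" for t
    using DERIV_chain2[OF d'[of "- t"] DERIV_minus[OF DERIV_ident]]
    by (simp add: algebra_simps)
  define E where "E t = a * (d t)\<^sup>2 + 2 * b * (d t * d (- t)) + a * (d (- t))\<^sup>2" for t
  have "(E has_real_derivative 0) (at t)" for t
    unfolding E_def
    by (auto intro!: derivative_eq_intros d' dm simp: algebra_simps power2_eq_square)
  then have "E t = E 0" for t
    using DERIV_isconst_all by blast
  moreover have "d 0 = 0" using w1 w2 by (simp add: d_def reflection_sol_def)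
  ultimately have E0: "E t = 0" for t by (simp add: E_def)
  have "d t = 0" for t
  proof -
    have "(a * d (- t) + b * d t)\<^sup>2 + (a\<^sup>2 - b\<^sup>2) * (d t)\<^sup>2 = a * E t"
      by (simp add: E_def power2_eq_square algebra_simps)
    then have "(a * d (- t) + b * d t)\<^sup>2 + (a\<^sup>2 - b\<^sup>2) * (d t)\<^sup>2 = 0"
      using E0[of t] by simp
    moreover have "(a * d (- t) + b * d t)\<^sup>2 \<ge> 0" by simp
    ultimately have "(a\<^sup>2 - b\<^sup>2) * (d t)\<^sup>2 \<le> 0" by linarith
    then show ?thesis
      using ab by (simp add: mult_le_0_iff)
  qed
  then show ?thesis by (auto simp: d_def fun_eq_iff)
qed

lemma ex1_reflection_sol:
  assumes "a\<^sup>2 > b\<^sup>2"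
  shows "\<exists>!w. reflection_sol a b w"
  using reflection_sol_explicit[OF assms] reflection_sol_unique[OF assms] by blast

text \<open>The closed form of the Green's function in the range \<open>a\<^sup>2 > b\<^sup>2\<close>.\<close>

lemma green_closed_form:
  fixes a b :: real
  assumes ab: "a\<^sup>2 > b\<^sup>2"
  defines "\<omega> \<equiv> sqrt (a\<^sup>2 - b\<^sup>2)"
  shows "green a b t s =
      (cos (\<omega> * (s - t)) + b / \<omega> * sin (\<omega> * (s - t))) * oriented_chi 0 t s
      + a / \<omega> * sin (\<omega> * (s + t)) * oriented_chi (- t) 0 s"
proof -
  have pos: "\<omega> > 0" and sq: "\<omega> * \<omega> = (a + b) * (a - b)"
    using ab by (simp_all add: \<omega>_def power2_eq_square algebra_simps)
  define p q where "p = (a + b) / \<omega>" and "q = (a - b) / \<omega>"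
  have pq: "p * q = 1" and p_minus_q: "p - q = 2 * (b / \<omega>)" and p_plus_q: "p + q = 2 * (a / \<omega>)"
    using pos sq by (simp_all add: p_def q_def field_simps)
  have u: "utilde a b = (\<lambda>t. cos (\<omega> * t) - p * sin (\<omega> * t))"
    unfolding utilde_def p_def \<omega>_def
    by (rule the1_equality, rule ex1_reflection_sol[OF ab], rule reflection_sol_explicit[OF ab])
  have ab': "(- a)\<^sup>2 > b\<^sup>2" using ab by simp
  have "vtilde a b = (\<lambda>t. cos (sqrt ((- a)\<^sup>2 - b\<^sup>2) * t)
      - (- a + b) / sqrt ((- a)\<^sup>2 - b\<^sup>2) * sin (sqrt ((- a)\<^sup>2 - b\<^sup>2) * t))"
    unfolding vtilde_def
    by (rule the1_equality, rule ex1_reflection_sol[OF ab'], rule reflection_sol_explicit[OF ab'])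
  then have v: "vtilde a b = (\<lambda>t. cos (\<omega> * t) + q * sin (\<omega> * t))"
    by (simp add: q_def \<omega>_def diff_divide_distrib fun_eq_iff algebra_simps)
  define cs ss ct st where
    "cs = cos (\<omega> * s)" and "ss = sin (\<omega> * s)" and "ct = cos (\<omega> * t)" and "st = sin (\<omega> * t)"
  have cdiff: "cos (\<omega> * (s - t)) = cs * ct + ss * st"
    and sdiff: "sin (\<omega> * (s - t)) = ss * ct - cs * st"
    and ssum: "sin (\<omega> * (s + t)) = ss * ct + cs * st"
    by (simp_all add: cs_def ss_def ct_def st_def right_diff_distrib distrib_left
        cos_diff sin_diff sin_add)
  have us: "utilde a b (- s) = cs + p * ss" and vs: "vtilde a b (- s) = cs - q * ss"
    and ut: "utilde a b t = ct - p * st" and vt: "vtilde a b t = ct + q * st"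
    by (simp_all add: u v cs_def ss_def ct_def st_def)
  have "(cs + p * ss) * (ct + q * st) + (cs - q * ss) * (ct - p * st)
      = 2 * (cs * ct) + 2 * (p * q) * (ss * st) + (p - q) * (ss * ct - cs * st)"
    by (simp add: algebra_simps)
  then have 1: "(cs + p * ss) * (ct + q * st) + (cs - q * ss) * (ct - p * st)
      = 2 * (cs * ct + ss * st + b / \<omega> * (ss * ct - cs * st))"
    unfolding pq p_minus_q by (simp only: distrib_left mult.assoc mult_1_left)
  have "(cs + p * ss) * (ct + q * st) - (cs - q * ss) * (ct - p * st)
      = (p + q) * (ss * ct + cs * st)"
    by (simp add: algebra_simps)
  then have 2: "(cs + p * ss) * (ct + q * st) - (cs - q * ss) * (ct - p * st)
      = 2 * (a / \<omega> * (ss * ct + cs * st))"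
    unfolding p_plus_q by simp
  show ?thesis
    unfolding green_def us vs ut vt 1 2 cdiff sdiff ssum by (simp add: algebra_simps)
qed

lemma green_origin: "a\<^sup>2 > b\<^sup>2 \<Longrightarrow> green a b 0 0 = 1"
  by (simp add: green_closed_form oriented_chi_def)

end

theory Submission
  imports Defs
begin

text \<open>
  Write \<open>\<omega> = sqrt (a\<^sup>2 - b\<^sup>2)\<close> and \<open>\<eta> = eta a b\<close>. In the half plane \<open>t > 0\<close> the Green's function
  lives on two triangles: for \<open>0 < s \<le> t\<close> it is \<open>Q (t - s)\<close> with
  \<open>Q y = cos (\<omega> y) - b / \<omega> sin (\<omega> y)\<close>, and for \<open>- t \<le> s < 0\<close> it is \<open>a / \<omega> sin (\<omega> (s + t))\<close>; on the
  common edge \<open>s = 0\<close> the two expressions are added. The number \<open>\<eta>\<close> is exactly the first positive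
  zero of \<open>Q\<close>, it lies in \<open>(0, \<pi> / \<omega>)\<close>, and \<open>Q y = sin (\<omega> (\<eta> - y)) / sin (\<omega> \<eta>)\<close>
  (\<open>eta_bounds\<close>, \<open>cos_minus_sin_eq_shifted_sin\<close>). This settles \<open>t > 0\<close>: for \<open>a > 0\<close> and \<open>t \<le> \<eta>\<close> both
  pieces are non-negative; as soon as \<open>t > \<eta>\<close> the first piece takes the value \<open>Q 0 = 1\<close> and also
  values of \<open>Q\<close> just beyond its zero, which are negative; and for \<open>a < 0\<close> the value \<open>1\<close> of the first
  piece on the diagonal is opposed by the negative values of the second one near \<open>s = - t\<close>.

  The half plane \<open>t < 0\<close> follows from the reflection \<open>(t, s) \<mapsto> (- t, - s)\<close>, which exchanges \<open>(a, b)\<close>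
  with \<open>(- a, - b)\<close> and reverses the sign of the Green's function off the axis \<open>s = 0\<close>
  (\<open>green_reflect\<close>); on the axis the sign for \<open>t < 0\<close> is that of a single sine. In both half planes
  a sign change outside the optimal strip already occurs on every single vertical line.
\<close>

section \<open>The first zero of the diagonal kernel\<close>

text \<open>The case distinction in \<open>eta\<close> makes \<open>\<omega> * eta a b\<close> the value of \<open>arccot (b / \<omega>)\<close> on the branch with
  range \<open>(0, \<pi>)\<close>.\<close>

lemma eta_bounds:
  fixes a b :: real
  assumes ab: "a\<^sup>2 > b\<^sup>2"
  defines "\<omega> \<equiv> sqrt (a\<^sup>2 - b\<^sup>2)"
  shows "\<omega> * eta a b > 0" and "\<omega> * eta a b < pi"
    and "\<omega> * cos (\<omega> * eta a b) = b * sin (\<omega> * eta a b)"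
proof -
  have pos: "\<omega> > 0" using ab by (simp add: \<omega>_def)
  define \<theta> where "\<theta> = arctan (\<omega> / b)"
  have bnd: "- (pi / 2) < \<theta>" "\<theta> < pi / 2"
    using arctan_bounded[of "\<omega> / b"] by (simp_all add: \<theta>_def)
  have root: "\<omega> * cos \<theta> = b * sin \<theta>" if "b \<noteq> 0"
  proof -
    have "sin \<theta> / cos \<theta> = \<omega> / b"
      using tan_arctan[of "\<omega> / b"] by (simp add: \<theta>_def tan_def)
    moreover have "cos \<theta> \<noteq> 0"
      by (simp add: \<theta>_def)
    ultimately show ?thesis using that by (simp add: field_simps)
  qed
  have "\<omega> * eta a b > 0 \<and> \<omega> * eta a b < pi \<and> \<omega> * cos (\<omega> * eta a b) = b * sin (\<omega> * eta a b)"
  proof (cases b "0::real" rule: linorder_cases)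
    case less
    then have "\<theta> < 0" using pos by (simp add: \<theta>_def divide_pos_neg)
    moreover have "\<omega> * eta a b = \<theta> + pi"
      using less pos by (simp add: eta_def \<theta>_def \<omega>_def)
    ultimately show ?thesis using bnd root less by simp
  next
    case equal
    then have "\<omega> = \<bar>a\<bar>" by (simp add: \<omega>_def)
    then have "\<omega> * eta a b = pi / 2"
      using pos equal by (simp add: eta_def)
    then show ?thesis unfolding \<open>\<omega> * eta a b = pi / 2\<close> using equal by simp
  next
    case greater
    then have "\<theta> > 0" using pos by (simp add: \<theta>_def)
    moreover have "\<omega> * eta a b = \<theta>"
      using greater pos by (simp add: eta_def \<theta>_def \<omega>_def)
    ultimately show ?thesis using bnd root greater by simp
  qed
  then show "\<omega> * eta a b > 0" "\<omega> * eta a b < pi"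
    "\<omega> * cos (\<omega> * eta a b) = b * sin (\<omega> * eta a b)" by auto
qed

text \<open>The left-hand side is a sinusoid that vanishes at \<open>y = eta a b\<close> and equals \<open>1\<close> at \<open>y = 0\<close>. In the
  form on the right its sign can be read off from the distance of \<open>y\<close> to the zero.\<close>

lemma cos_minus_sin_eq_shifted_sin:
  fixes a b y :: real
  assumes ab: "a\<^sup>2 > b\<^sup>2"
  defines "\<omega> \<equiv> sqrt (a\<^sup>2 - b\<^sup>2)"
  shows "cos (\<omega> * y) - b / \<omega> * sin (\<omega> * y) = sin (\<omega> * (eta a b - y)) / sin (\<omega> * eta a b)"
proof -
  have pos: "\<omega> > 0" using ab by (simp add: \<omega>_def)
  have s: "sin (\<omega> * eta a b) > 0"
    using eta_bounds(1,2)[OF ab] by (intro sin_gt_zero) (simp_all add: \<omega>_def)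
  have "cos (\<omega> * eta a b) = b / \<omega> * sin (\<omega> * eta a b)"
    using eta_bounds(3)[OF ab] pos by (simp add: \<omega>_def field_simps)
  then have "sin (\<omega> * (eta a b - y))
      = sin (\<omega> * eta a b) * (cos (\<omega> * y) - b / \<omega> * sin (\<omega> * y))"
    by (simp add: right_diff_distrib sin_diff algebra_simps)
  then show ?thesis using s by simp
qed

lemma eta_minus_left: "eta (- a) b = eta a b"
  by (simp add: eta_def)

section \<open>The Green's function on the right half plane and its reflection\<close>

lemma green_between_axis_and_diagonal:
  assumes ab: "a\<^sup>2 > b\<^sup>2" and s: "0 < s" "s \<le> t"
  shows "green a b t s = sin (sqrt (a\<^sup>2 - b\<^sup>2) * (eta a b - (t - s)))
    / sin (sqrt (a\<^sup>2 - b\<^sup>2) * eta a b)"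
proof -
  have "cos (\<omega> * (s - t)) = cos (\<omega> * (t - s))" "sin (\<omega> * (s - t)) = - sin (\<omega> * (t - s))" for \<omega>
    using cos_minus[of "\<omega> * (t - s)"] sin_minus[of "\<omega> * (t - s)"] by (simp_all add: algebra_simps)
  then have "green a b t s = cos (sqrt (a\<^sup>2 - b\<^sup>2) * (t - s))
      - b / sqrt (a\<^sup>2 - b\<^sup>2) * sin (sqrt (a\<^sup>2 - b\<^sup>2) * (t - s))"
    unfolding green_closed_form[OF ab] using s by (simp add: oriented_chi_def)
  then show ?thesis
    by (simp only: cos_minus_sin_eq_shifted_sin[OF ab])
qed

lemma green_between_antidiagonal_and_axis:
  assumes ab: "a\<^sup>2 > b\<^sup>2" and s: "- t \<le> s" "s < 0"
  shows "green a b t s = a / sqrt (a\<^sup>2 - b\<^sup>2) * sin (sqrt (a\<^sup>2 - b\<^sup>2) * (s + t))"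
  using s by (simp add: green_closed_form[OF ab] oriented_chi_def)

lemma green_positive_axis:
  assumes ab: "a\<^sup>2 > b\<^sup>2" and t: "0 \<le> t"
  shows "green a b t 0 = sin (sqrt (a\<^sup>2 - b\<^sup>2) * (eta a b - t)) / sin (sqrt (a\<^sup>2 - b\<^sup>2) * eta a b)
    + a / sqrt (a\<^sup>2 - b\<^sup>2) * sin (sqrt (a\<^sup>2 - b\<^sup>2) * t)"
  unfolding cos_minus_sin_eq_shifted_sin[OF ab, symmetric]
  using t by (simp add: green_closed_form[OF ab] oriented_chi_def)

lemma green_negative_axis:
  assumes ab: "a\<^sup>2 > b\<^sup>2" and t: "t < 0"
  shows "green a b t 0 = - (a / sqrt (a\<^sup>2 - b\<^sup>2) * sin (sqrt (a\<^sup>2 - b\<^sup>2) * t))"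
  using t by (simp add: green_closed_form[OF ab] oriented_chi_def)

lemma green_eq_0:
  assumes ab: "a\<^sup>2 > b\<^sup>2" and "0 \<le> t" "t < \<bar>s\<bar>"
  shows "green a b t s = 0"
proof -
  have "oriented_chi 0 t s = 0" "oriented_chi (- t) 0 s = 0"
    using assms(2,3) by (auto simp: oriented_chi_def)
  then show ?thesis by (simp add: green_closed_form[OF ab])
qed

text \<open>If \<open>w\<close> solves \<open>w'(t) + a w(-t) + b w(t) = 0\<close>, then \<open>t \<mapsto> w (- t)\<close> solves the equation for
  \<open>(- a, - b)\<close>, and reflecting an interval of integration reverses its orientation. The axis \<open>s = 0\<close> is
  excluded because the oriented characteristic function includes both endpoints for one orientation
  and only one of them for the other.\<close>

lemma green_reflect:
  assumes ab: "a\<^sup>2 > b\<^sup>2" and s: "s \<noteq> 0"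
  shows "green a b (- t) (- s) = - green (- a) (- b) t s"
proof -
  define \<omega> where "\<omega> = sqrt (a\<^sup>2 - b\<^sup>2)"
  have ab': "(- a)\<^sup>2 > (- b)\<^sup>2" using ab by simp
  have w: "sqrt ((- a)\<^sup>2 - (- b)\<^sup>2) = \<omega>" by (simp add: \<omega>_def)
  have c: "cos (\<omega> * (- s - - t)) = cos (\<omega> * (s - t))"
    and d: "sin (\<omega> * (- s - - t)) = - sin (\<omega> * (s - t))"
    and e: "sin (\<omega> * (- s + - t)) = - sin (\<omega> * (s + t))"
    using cos_minus[of "\<omega> * (s - t)"] sin_minus[of "\<omega> * (s - t)"] sin_minus[of "\<omega> * (s + t)"]
    by (simp_all add: algebra_simps)
  have "oriented_chi 0 (- t) (- s) = - oriented_chi 0 t s"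
    using s by (auto simp: oriented_chi_def)
  \<comment> \<open>On the line \<open>s = - t\<close> the second pair of characteristic functions disagrees,
    but there it is multiplied by \<open>sin 0\<close>.\<close>
  moreover have "sin (\<omega> * (s + t)) * oriented_chi (- (- t)) 0 (- s)
      = - sin (\<omega> * (s + t)) * oriented_chi (- t) 0 s"
  proof (cases "s + t = 0")
    case True
    show ?thesis unfolding True by simp
  next
    case False
    then have "oriented_chi (- (- t)) 0 (- s) = - oriented_chi (- t) 0 s"
      using s by (auto simp: oriented_chi_def)
    then show ?thesis by simp
  qed
  ultimately show ?thesis
    unfolding green_closed_form[OF ab] green_closed_form[OF ab'] w
    unfolding \<omega>_def[symmetric] c d e
    by (simp add: mult.assoc)
qed

section \<open>Constant sign on the strips\<close>

text \<open>The strip ends at \<open>eta a b < \<pi> / \<omega>\<close>, so every sine that occurs has its argument in one half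
  period; on the axis \<open>s = 0\<close> a sum of two non-negative terms appears.\<close>

lemma green_nonneg:
  assumes ab: "a\<^sup>2 > b\<^sup>2" and a: "a > 0" and t: "0 \<le> t" "t \<le> eta a b"
  shows "green a b t s \<ge> 0"
proof -
  define \<omega> where "\<omega> = sqrt (a\<^sup>2 - b\<^sup>2)"
  have pos: "\<omega> > 0" using ab by (simp add: \<omega>_def)
  have eta: "\<omega> * eta a b > 0" "\<omega> * eta a b < pi"
    using eta_bounds(1,2)[OF ab] by (simp_all add: \<omega>_def)
  have sin: "sin (\<omega> * y) \<ge> 0" if "0 \<le> y" "y \<le> eta a b" for y
  proof (rule sin_ge_zero)
    show "0 \<le> \<omega> * y" using that pos by simp
    have "\<omega> * y \<le> \<omega> * eta a b" using that pos by simp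
    then show "\<omega> * y \<le> pi" using eta by simp
  qed
  consider "0 < s" "s \<le> t" | "s = 0" | "- t \<le> s" "s < 0" | "t < \<bar>s\<bar>" by linarith
  then show ?thesis
  proof cases
    case 1
    then show ?thesis
      using t sin[of "eta a b - (t - s)"] sin[of "eta a b"]
      by (simp add: green_between_axis_and_diagonal[OF ab] \<omega>_def[symmetric])
  next
    case 2
    then show ?thesis
      using t a pos sin[of "eta a b - t"] sin[of "eta a b"] sin[of t]
      by (simp add: green_positive_axis[OF ab] \<omega>_def[symmetric])
  next
    case 3
    then show ?thesis
      using t a pos sin[of "s + t"]
      by (simp add: green_between_antidiagonal_and_axis[OF ab] \<omega>_def[symmetric])
  next
    case 4
    then show ?thesis using t by (simp add: green_eq_0[OF ab])
  qed
qed

text \<open>Away from the axis this is the reflection of \<open>green_nonneg\<close>. On the axis only the term with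
  \<open>oriented_chi (- t) 0\<close> is present for \<open>t < 0\<close>, and its sign is known because \<open>eta a (- b) < \<pi> / \<omega>\<close>.
  At the origin the Green's function is \<open>1\<close>.\<close>

lemma green_nonpos:
  assumes ab: "a\<^sup>2 > b\<^sup>2" and a: "a < 0" and t: "- eta a (- b) \<le> t" "t \<le> 0"
    and nz: "(t, s) \<noteq> (0, 0)"
  shows "green a b t s \<le> 0"
proof (cases "s = 0")
  case False
  have "green (- a) (- b) (- t) (- s) \<ge> 0"
    using ab a t by (intro green_nonneg) (simp_all add: eta_minus_left)
  then show ?thesis using green_reflect[OF ab, of "- s" "- t"] False by simp
next
  case True
  define \<omega> where "\<omega> = sqrt (a\<^sup>2 - b\<^sup>2)"
  have pos: "\<omega> > 0" using ab by (simp add: \<omega>_def)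
  have "\<omega> * eta a (- b) < pi"
    using eta_bounds(2)[of "- b" a] ab by (simp add: \<omega>_def)
  moreover have "\<omega> * - t \<le> \<omega> * eta a (- b)"
    using pos t by (intro mult_left_mono) simp_all
  ultimately have "sin (\<omega> * - t) \<ge> 0"
    using pos t by (intro sin_ge_zero) (simp_all add: mult_nonneg_nonpos)
  then have "a / \<omega> * sin (\<omega> * t) \<ge> 0"
    using a pos by (simp add: mult_nonpos_nonpos divide_nonpos_pos)
  then show ?thesis
    using True nz t by (simp add: green_negative_axis[OF ab] \<omega>_def[symmetric])
qed

section \<open>Sign changes on vertical lines\<close>

lemma changes_sign_on_mono:
  "changes_sign_on S F \<Longrightarrow> S \<subseteq> T \<Longrightarrow> changes_sign_on T F"
  unfolding changes_sign_on_def by blast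

lemma changes_sign_on_lineI:
  assumes "p \<noteq> 0" "F t p > 0" and "n \<noteq> 0" "F t n < 0"
  shows "changes_sign_on ({t} \<times> (- {0})) F"
  using assms unfolding changes_sign_on_def by auto

lemma obtain_small_sin_pos:
  fixes \<omega> d :: real
  assumes "\<omega> > 0" "d > 0"
  obtains e where "0 < e" "e < d" "sin (\<omega> * e) > 0"
proof -
  have "pi / \<omega> > 0" using assms by simp
  then obtain e where e: "0 < e" "e < d" "e < pi / \<omega>"
    using field_lbound_gt_zero[OF \<open>d > 0\<close>] by blast
  then have "\<omega> * e < pi" using assms by (simp add: field_simps)
  then have "sin (\<omega> * e) > 0" using e assms by (intro sin_gt_zero) simp_all
  with e show ?thesis using that by blast
qed

lemma green_diagonal:
  assumes ab: "a\<^sup>2 > b\<^sup>2" and "t > 0"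
  shows "green a b t t = 1"
  using assms(2) by (simp add: green_closed_form[OF ab] oriented_chi_def)

text \<open>The point \<open>s = 0\<close> of each vertical line is left out so that \<open>green_reflect\<close> carries sign changes from
  one half plane to the other.\<close>

lemma green_changes_sign_beyond_eta:
  assumes ab: "a\<^sup>2 > b\<^sup>2" and t: "t > eta a b"
  shows "changes_sign_on ({t} \<times> (- {0})) (green a b)"
proof -
  define \<omega> where "\<omega> = sqrt (a\<^sup>2 - b\<^sup>2)"
  have pos: "\<omega> > 0" using ab by (simp add: \<omega>_def)
  have eta: "\<omega> * eta a b > 0" "\<omega> * eta a b < pi"
    using eta_bounds(1,2)[OF ab] by (simp_all add: \<omega>_def)
  then have eta0: "eta a b > 0" using pos by (simp add: zero_less_mult_iff)
  obtain e where e: "0 < e" "e < t - eta a b" "sin (\<omega> * e) > 0"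
    using obtain_small_sin_pos[of \<omega> "t - eta a b"] pos t by auto
  define s where "s = t - (eta a b + e)"
  have s: "0 < s" "s \<le> t" using e eta0 by (simp_all add: s_def)
  have "eta a b - (t - s) = - e" by (simp add: s_def)
  then have "green a b t s = - sin (\<omega> * e) / sin (\<omega> * eta a b)"
    using green_between_axis_and_diagonal[OF ab s] by (simp add: \<omega>_def)
  moreover have "sin (\<omega> * eta a b) > 0"
    using eta by (rule sin_gt_zero)
  ultimately have "green a b t s < 0" using e by simp
  moreover have "green a b t t = 1" "t > 0"
    using t eta0 by (simp_all add: green_diagonal[OF ab])
  ultimately show ?thesis
    using s by (intro changes_sign_on_lineI[of t _ _ s]) simp_all
qed

text \<open>Just inside the line \<open>s = - t\<close> the Green's function has the sign of \<open>a\<close>, however small \<open>t\<close> is,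
  so that for \<open>a < 0\<close> no strip of constant sign reaches into the right half plane.\<close>

lemma green_changes_sign_of_neg:
  assumes ab: "a\<^sup>2 > b\<^sup>2" and a: "a < 0" and t: "t > 0"
  shows "changes_sign_on ({t} \<times> (- {0})) (green a b)"
proof -
  define \<omega> where "\<omega> = sqrt (a\<^sup>2 - b\<^sup>2)"
  have pos: "\<omega> > 0" using ab by (simp add: \<omega>_def)
  obtain e where e: "0 < e" "e < t" "sin (\<omega> * e) > 0"
    using obtain_small_sin_pos[OF pos t] by blast
  have "green a b t (e - t) = a / \<omega> * sin (\<omega> * e)"
    using green_between_antidiagonal_and_axis[OF ab, of t "e - t"] e by (simp add: \<omega>_def)
  then have "green a b t (e - t) < 0"
    using a pos e by (simp add: mult_neg_pos divide_neg_pos)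
  moreover have "green a b t t = 1" by (rule green_diagonal[OF ab t])
  ultimately show ?thesis
    using t e by (intro changes_sign_on_lineI[of t _ _ "e - t"]) simp_all
qed

lemma green_changes_sign_reflect:
  assumes ab: "a\<^sup>2 > b\<^sup>2" and ch: "changes_sign_on ({- t} \<times> (- {0})) (green (- a) (- b))"
  shows "changes_sign_on ({t} \<times> (- {0})) (green a b)"
proof -
  obtain p n where "p \<noteq> 0" "green (- a) (- b) (- t) p > 0"
    and "n \<noteq> 0" "green (- a) (- b) (- t) n < 0"
    using ch unfolding changes_sign_on_def by auto
  then have "green a b t (- p) < 0" "- p \<noteq> 0" "green a b t (- n) > 0" "- n \<noteq> 0"
    using green_reflect[OF ab, of p "- t"] green_reflect[OF ab, of n "- t"] by simp_all
  then show ?thesis by (intro changes_sign_on_lineI[of "- n" _ _ "- p"])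
qed

lemma obtain_line_outside_strip:
  assumes "\<not> strip \<alpha> \<beta> \<subseteq> strip l r"
  obtains t where "t \<in> {\<alpha>..\<beta>}" "t < l \<or> t > r"
  using assms unfolding strip_def by force

section \<open>Optimal strips of constant sign\<close>

theorem lemma3p2:
  fixes a b :: real
  assumes "a\<^sup>2 > b\<^sup>2"
  shows "(a > 0 \<longrightarrow> nonneg_on (strip 0 (eta a b)) (green a b))
    \<and> (a < 0 \<longrightarrow> nonpos_on (strip (- eta a (- b)) 0 - {(0, 0)}) (green a b))
    \<and> (\<forall>\<alpha> \<beta>.
        (a > 0 \<and> \<not> strip \<alpha> \<beta> \<subseteq> strip 0 (eta a b)
          \<longrightarrow> changes_sign_on (strip \<alpha> \<beta> - {(0, 0)}) (green a b))
      \<and> (a < 0 \<and> \<not> strip \<alpha> \<beta> \<subseteq> strip (- eta a (- b)) 0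
          \<longrightarrow> changes_sign_on (strip \<alpha> \<beta> - {(0, 0)}) (green a b)))"
proof -
  have ab': "(- a)\<^sup>2 > (- b)\<^sup>2" using assms by simp
  have line: "changes_sign_on (strip \<alpha> \<beta> - {(0, 0)}) (green a b)"
    if "t \<in> {\<alpha>..\<beta>}" "changes_sign_on ({t} \<times> (- {0})) (green a b)" for \<alpha> \<beta> t
    using that(1) by (intro changes_sign_on_mono[OF that(2)]) (auto simp: strip_def)
  have pos: "changes_sign_on (strip \<alpha> \<beta> - {(0, 0)}) (green a b)"
    if a: "a > 0" and ns: "\<not> strip \<alpha> \<beta> \<subseteq> strip 0 (eta a b)" for \<alpha> \<beta>
  proof -
    obtain t where t: "t \<in> {\<alpha>..\<beta>}" and out: "t < 0 \<or> t > eta a b"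
      using obtain_line_outside_strip[OF ns] by blast
    from out have "changes_sign_on ({t} \<times> (- {0})) (green a b)"
    proof
      assume "t < 0"
      then show ?thesis
        using a by (intro green_changes_sign_reflect[OF assms] green_changes_sign_of_neg[OF ab']) simp_all
    qed (rule green_changes_sign_beyond_eta[OF assms])
    then show ?thesis by (rule line[OF t])
  qed
  have neg: "changes_sign_on (strip \<alpha> \<beta> - {(0, 0)}) (green a b)"
    if a: "a < 0" and ns: "\<not> strip \<alpha> \<beta> \<subseteq> strip (- eta a (- b)) 0" for \<alpha> \<beta>
  proof -
    obtain t where t: "t \<in> {\<alpha>..\<beta>}" and out: "t < - eta a (- b) \<or> t > 0"
      using obtain_line_outside_strip[OF ns] by blast
    from out have "changes_sign_on ({t} \<times> (- {0})) (green a b)"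
    proof
      assume "t < - eta a (- b)"
      then show ?thesis
        by (intro green_changes_sign_reflect[OF assms] green_changes_sign_beyond_eta[OF ab'])
          (simp add: eta_minus_left)
    qed (rule green_changes_sign_of_neg[OF assms a])
    then show ?thesis by (rule line[OF t])
  qed
  have "nonneg_on (strip 0 (eta a b)) (green a b)" if "a > 0"
    using green_nonneg[OF assms that] by (auto simp: nonneg_on_def strip_def)
  moreover have "nonpos_on (strip (- eta a (- b)) 0 - {(0, 0)}) (green a b)" if "a < 0"
    unfolding nonpos_on_def
  proof (rule ballI, rule case_prodI2)
    fix p t s
    assume "p \<in> strip (- eta a (- b)) 0 - {(0, 0)}" "p = (t, s)"
    then show "green a b t s \<le> 0"
      by (intro green_nonpos[OF assms that]) (simp_all add: strip_def)
  qed
  ultimately show ?thesis using pos neg by blast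
qed

end
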